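(* Let $\mathbb{K}$ be a field, $\rho:\mathbb{N}^+\to\mathbb{K}$ any function, and $f(x)\in\mathbb{K}[[x]]$ with $$1+\sum_{n\ge 1}\Big(\sum_{F\in PF(n)}\prod_{h\in\mathcal{H}(F)}\rho(h)\Big)x^n=f(x).$$ Then for every $n\ge1$ with $[x^{n-1}]f(x)\neq0$, $$\rho(n)=-\frac{[x^n]f(x)^{-1}}{[x^{n-1}]f(x)}.$$
   Context: A plane tree is a rooted unlabeled tree in which the (nonempty) subtrees of each vertex are arranged in linear order. A plane forest is a linearly ordered sequence of (nonempty) plane trees; $PF(n)$ is the set of plane forests with $n$ vertices in total. For a vertex $u$ of a forest $F$, the hook length $h_u$ is the number of descendants of $u$ in its tree (counting $u$ itself), and $\mathcal{H}(F)$ is the multiset of hook lengths of all vertices of $F$; the product is over all vertices. $[x^n]g(x)$ is the coefficient of $x^n$ in $g(x)$. *)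

theory Defs
  imports
    "HOL-Library.Multiset"
    "HOL-Computational_Algebra.Formal_Power_Series"
begin

text \<open>
  A plane tree is a root together with the ordered list of the (nonempty) subtrees of the root;
  a plane forest is a list of plane trees.
\<close>

datatype plane_tree = Node "plane_tree list"

type_synonym plane_forest = "plane_tree list"

fun tree_order :: "plane_tree \<Rightarrow> nat" where
  "tree_order (Node ts) = 1 + (\<Sum>t\<leftarrow>ts. tree_order t)"

definition forest_order :: "plane_forest \<Rightarrow> nat" where
  "forest_order F = (\<Sum>t\<leftarrow>F. tree_order t)"

definition PF :: "nat \<Rightarrow> plane_forest set" where
  "PF n = {F. forest_order F = n}"

text \<open>
  Vertices are represented by the subtrees rooted at them: the multiset below has one entry
  for each vertex, namely the tree formed by that vertex and all its descendants.
\<close>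

fun vertex_subtrees :: "plane_tree \<Rightarrow> plane_tree multiset" where
  "vertex_subtrees (Node ts) = add_mset (Node ts) (\<Sum>t\<leftarrow>ts. vertex_subtrees t)"

text \<open>
  The hook length of a vertex counts its descendants including the vertex itself, that is,
  the vertices of the subtree rooted at it.
\<close>

definition hook_lengths :: "plane_forest \<Rightarrow> nat multiset" where
  "hook_lengths F = image_mset tree_order (\<Sum>t\<leftarrow>F. vertex_subtrees t)"

lemma size_hook_lengths: "size (hook_lengths F) = forest_order F"
proof -
  have sum: "size (\<Sum>t\<leftarrow>ts. vertex_subtrees t) = (\<Sum>t\<leftarrow>ts. size (vertex_subtrees t))" for ts
    by (induction ts) auto
  have "size (vertex_subtrees t) = tree_order t" for t
    by (induction t) (simp add: sum cong: map_cong)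
  then show ?thesis
    by (simp add: hook_lengths_def forest_order_def sum)
qed

text \<open>Finiteness ensures that sums over \<open>PF n\<close> are not zero by convention.\<close>

lemma finite_PF: "finite (PF n)"
proof (induction n rule: less_induct)
  case (less n)
  let ?A = "\<Union>k<n. PF k"
  have "PF n \<subseteq> insert [] ((\<lambda>(ts, F). Node ts # F) ` (?A \<times> ?A))"
  proof
    fix F assume F: "F \<in> PF n"
    show "F \<in> insert [] ((\<lambda>(ts, F). Node ts # F) ` (?A \<times> ?A))"
    proof (cases F)
      case (Cons t G)
      obtain ts where t: "t = Node ts" by (cases t)
      have "n = 1 + forest_order ts + forest_order G"
        using F by (simp add: PF_def forest_order_def Cons t)
      then have "ts \<in> ?A" "G \<in> ?A" by (auto simp: PF_def)
      then show ?thesis using Cons t by auto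
    qed simp
  qed
  moreover have "finite ?A" using less by auto
  ultimately show ?case
    using finite_subset by (metis (no_types) finite_SigmaI finite_imageI finite.insertI)
qed

end

theory Submission
  imports Defs
begin

text \<open>
  Splitting off the first tree of a nonempty forest and deleting its root is a bijection onto pairs
  of forests. It multiplies the weight by \<open>\<rho>\<close> of the size of that tree, so that
  \<open>f = 1 + x h f\<close> with \<open>h = \<Sum>k. \<rho> (k + 1) f\<^sub>k x\<^sup>k\<close>. Hence \<open>1 / f = 1 - x h\<close>, and the claim is
  read off by comparing coefficients.
\<close>

definition forest_weight :: "(nat \<Rightarrow> 'a :: comm_monoid_mult) \<Rightarrow> plane_forest \<Rightarrow> 'a" where
  "forest_weight \<rho> F = (\<Prod>h\<in>#hook_lengths F. \<rho> h)"

lemma forest_weight_Nil [simp]: "forest_weight \<rho> [] = 1"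
  by (simp add: forest_weight_def hook_lengths_def)

text \<open>Deleting the root of the first tree removes the hook length
  \<open>Suc (forest_order ts)\<close>. All other hook lengths survive, as the root is a descendant
  of no other vertex.\<close>

lemma forest_weight_Cons:
  "forest_weight \<rho> (Node ts # F) =
     \<rho> (Suc (forest_order ts)) * forest_weight \<rho> ts * forest_weight \<rho> F"
  by (simp add: forest_weight_def hook_lengths_def forest_order_def mult.assoc)

lemma PF_0: "PF 0 = {[]}"
proof -
  have pos: "tree_order t \<noteq> 0" for t by (cases t) simp
  have "F = []" if "forest_order F = 0" for F
    using that by (cases F) (simp_all add: forest_order_def pos)
  then show ?thesis
    by (auto simp: PF_def forest_order_def)
qed

text \<open>The index \<open>k\<close> counts the vertices below the first root, which leaves
  \<open>n - k\<close> for the later trees.\<close>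

lemma PF_Suc:
  "PF (Suc n) = (\<Union>k\<le>n. (\<lambda>(ts, F). Node ts # F) ` (PF k \<times> PF (n - k)))"
proof (rule set_eqI)
  fix G
  show "G \<in> PF (Suc n) \<longleftrightarrow> G \<in> (\<Union>k\<le>n. (\<lambda>(ts, F). Node ts # F) ` (PF k \<times> PF (n - k)))"
  proof (cases G)
    case Nil
    then show ?thesis by (auto simp: PF_def forest_order_def)
  next
    case (Cons t F)
    obtain ts where "t = Node ts" by (cases t)
    then show ?thesis
      using Cons by (auto simp: PF_def forest_order_def image_iff)
  qed
qed

lemma sum_forest_weight_PF_Suc:
  fixes \<rho> :: "nat \<Rightarrow> 'a :: comm_semiring_1"
  shows "(\<Sum>F\<in>PF (Suc n). forest_weight \<rho> F) =
    (\<Sum>k\<le>n. \<rho> (Suc k) * (\<Sum>F\<in>PF k. forest_weight \<rho> F) * (\<Sum>F\<in>PF (n - k). forest_weight \<rho> F))"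
proof -
  let ?c = "\<lambda>(ts, F). Node ts # F"
  have "(\<Sum>F\<in>PF (Suc n). forest_weight \<rho> F) =
      (\<Sum>k\<le>n. \<Sum>F\<in>?c ` (PF k \<times> PF (n - k)). forest_weight \<rho> F)"
    \<comment> \<open>Distinct \<open>k\<close> give disjoint images, because \<open>k\<close> is
      the order of the forest below the first root.\<close>
    unfolding PF_Suc by (rule sum.UNION_disjoint) (auto simp: finite_PF, auto simp: PF_def)
  also have "\<dots> = (\<Sum>k\<le>n. \<Sum>(ts, F)\<in>PF k \<times> PF (n - k). forest_weight \<rho> (Node ts # F))"
    by (intro sum.cong refl, subst sum.reindex) (auto simp: inj_on_def intro!: sum.cong)
  \<comment> \<open>On \<open>PF k\<close> the factor contributed by the root depends on
    \<open>k\<close> alone, so the double sum factors.\<close>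
  also have "\<dots> = (\<Sum>k\<le>n. \<Sum>(ts, F)\<in>PF k \<times> PF (n - k).
      \<rho> (Suc k) * forest_weight \<rho> ts * forest_weight \<rho> F)"
    by (intro sum.cong refl) (auto simp: forest_weight_Cons PF_def)
  also have "\<dots> = (\<Sum>k\<le>n. \<rho> (Suc k) * (\<Sum>F\<in>PF k. forest_weight \<rho> F) *
      (\<Sum>F\<in>PF (n - k). forest_weight \<rho> F))"
    by (simp only: sum.cartesian_product [symmetric] mult.assoc sum_product)
      (simp add: sum_distrib_left)
  finally show ?thesis .
qed

theorem theorem3p4:
  fixes \<rho> :: "nat \<Rightarrow> 'k :: field" and f :: "'k fps"
  assumes "1 + Abs_fps (\<lambda>n. if n \<ge> 1 then \<Sum>F\<in>PF n. \<Prod>h\<in>#hook_lengths F. \<rho> h else 0) = f"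
  shows "\<forall>n\<ge>1. fps_nth f (n - 1) \<noteq> 0 \<longrightarrow>
           \<rho> n = - (fps_nth (inverse f) n / fps_nth f (n - 1))"
proof -
  \<comment> \<open>The summand 1 is the weight of the empty forest, so \<open>n = 0\<close> is no
    exception.\<close>
  have f_nth: "fps_nth f n = (\<Sum>F\<in>PF n. forest_weight \<rho> F)" for n
    unfolding assms [symmetric] by (cases n) (simp_all add: PF_0 forest_weight_def [symmetric])
  define h where "h = Abs_fps (\<lambda>k. \<rho> (Suc k) * fps_nth f k)"
  have h_nth: "fps_nth h k = \<rho> (Suc k) * fps_nth f k" for k
    by (simp add: h_def)
  have "f = 1 + fps_X * (h * f)"
  proof (rule fps_ext)
    fix n
    show "fps_nth f n = fps_nth (1 + fps_X * (h * f)) n"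
    proof (cases n)
      case 0
      then show ?thesis by (simp add: f_nth PF_0)
    next
      case (Suc m)
      then show ?thesis
        by (simp add: fps_mult_nth [of h f] h_nth f_nth sum_forest_weight_PF_Suc atMost_atLeast0)
    qed
  qed
  then have "f * (1 - fps_X * h) = 1"
    by (simp add: algebra_simps)
  then have inv: "inverse f = 1 - fps_X * h"
    by (rule fps_inverse_unique)
  show ?thesis
  proof (intro allI impI)
    fix n :: nat
    assume "n \<ge> 1" and nz: "fps_nth f (n - 1) \<noteq> 0"
    then obtain m where "n = Suc m" by (cases n) auto
    \<comment> \<open>As \<open>n\<close> is positive, the constant 1 in \<open>inverse f\<close>
      drops out, and the coefficient at \<open>Suc m\<close> is minus that of \<open>h\<close> at
      \<open>m\<close>.\<close>
    then show "\<rho> n = - (fps_nth (inverse f) n / fps_nth f (n - 1))"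
      using nz by (simp add: inv h_nth)
  qed
qed

end
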